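(* For $u,v,n\in\mathbb{N}$, let $C_4(u,v,n)$ be the number of partitions of $n$ into $u$ distinct parts congruent to $1$ modulo $4$ and $v$ distinct parts congruent to $3$ modulo $4$. Let $D_4(u,v,n)$ be the number of partitions $\lambda_1+\cdots+\lambda_s$ of $n$ (positive integer parts, $\lambda_1\ge\dots\ge\lambda_s$) satisfying: (1) $\lambda_i\neq 2$ for all $i$; (2) $\lambda_i-\lambda_{i+1}\ge5$ for all $1\le i<s$; (3) for all $1\le i<s$: if $\lambda_i-\lambda_{i+1}=5$ then $\lambda_i\equiv1,4\pmod 8$; if $\lambda_i-\lambda_{i+1}=6$ then $\lambda_i\equiv1,3,5,7\pmod 8$; if $\lambda_i-\lambda_{i+1}=7$ then $\lambda_i\equiv0,1,3,4,6,7\pmod 8$; if $\lambda_i-\lambda_{i+1}=8$ then $\lambda_i\equiv0,1,3,4,5,7\pmod 8$; and such that $u$ equals the number of parts congruent to $0$ or $1$ modulo $4$ plus twice the number of parts congruent to $6$ modulo $8$, and $v$ equals the number of parts congruent to $0$ or $3$ modulo $4$ plus twice the number of parts congruent to $2$ modulo $8$. Then $C_4(u,v,n)=D_4(u,v,n)$ for all $u,v,n$. *)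

theory Defs
  imports Main
begin

text \<open>A partition into distinct parts is a finite set of positive integers (its parts).
  C4 u v n counts partitions of n into u distinct parts congruent to 1 mod 4 and
  v distinct parts congruent to 3 mod 4 (and no other parts).\<close>

definition C4 :: "nat \<Rightarrow> nat \<Rightarrow> nat \<Rightarrow> nat" where
  "C4 u v n = card {S :: nat set. finite S \<and> (\<forall>x\<in>S. x mod 4 = 1 \<or> x mod 4 = 3) \<and>
       \<Sum>S = n \<and> card {x\<in>S. x mod 4 = 1} = u \<and> card {x\<in>S. x mod 4 = 3} = v}"

text \<open>A partition lambda_1 + ... + lambda_s (weakly decreasing, positive parts) is a list
  [lambda_1, ..., lambda_s]; list index i corresponds to lambda_(i+1).\<close>

definition D4_gap_ok :: "nat \<Rightarrow> nat \<Rightarrow> bool" where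
  "D4_gap_ok a b \<longleftrightarrow>
     (int a - int b \<ge> 5) \<and>
     (int a - int b = 5 \<longrightarrow> a mod 8 \<in> {1,4}) \<and>
     (int a - int b = 6 \<longrightarrow> a mod 8 \<in> {1,3,5,7}) \<and>
     (int a - int b = 7 \<longrightarrow> a mod 8 \<in> {0,1,3,4,6,7}) \<and>
     (int a - int b = 8 \<longrightarrow> a mod 8 \<in> {0,1,3,4,5,7})"

definition D4 :: "nat \<Rightarrow> nat \<Rightarrow> nat \<Rightarrow> nat" where
  "D4 u v n = card {xs :: nat list.
       (\<forall>i<length xs - 1. xs ! i \<ge> xs ! (i+1)) \<and>
       (\<forall>x\<in>set xs. x > 0) \<and> sum_list xs = n \<and>
       (\<forall>x\<in>set xs. x \<noteq> 2) \<and>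
       (\<forall>i. i + 1 < length xs \<longrightarrow> D4_gap_ok (xs ! i) (xs ! (i+1))) \<and>
       u = length (filter (\<lambda>x. x mod 4 = 0 \<or> x mod 4 = 1) xs)
           + 2 * length (filter (\<lambda>x. x mod 8 = 6) xs) \<and>
       v = length (filter (\<lambda>x. x mod 4 = 0 \<or> x mod 4 = 3) xs)
           + 2 * length (filter (\<lambda>x. x mod 8 = 2) xs)}"

end

theory Submission
  imports Defs "HOL-Computational_Algebra.Polynomial"
begin

text \<open>Let \<open>G\<^sub>m(x, y)\<close> be the generating function of the gap-restricted partitions with parts at most
  \<open>m\<close>, where a partition counted by \<open>D4 u v n\<close> has weight \<open>x\<^sup>u y\<^sup>v q\<^sup>n\<close>, let \<open>E\<^sub>m\<close> be the contribution
  of those with largest part \<open>m\<close>, and put \<open>B\<^sub>k = G\<^bsub>8k-3\<^esub> + E\<^bsub>8k-1\<^esub>\<close>. Removing the largest part gives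
  recurrences, from which one obtains by simultaneous induction the functional equations

  \<open>G\<^bsub>8k+1\<^esub>(x, y) = (1 + x q) B\<^sub>k(y q\<^sup>2, x q\<^sup>2)\<close> and
  \<open>G\<^bsub>8k+4\<^esub>(x, y) = (1 + x q) G\<^bsub>8k+1\<^esub>(y q\<^sup>2, x q\<^sup>2)\<close>.

  Since \<open>B\<^sub>k\<close> and \<open>G\<^bsub>8k+4\<^esub>\<close> agree modulo \<open>q\<^bsup>8k-2\<^esup>\<close>, modulo this power \<open>G\<^bsub>8k+4\<^esub>(x, y)\<close> is
  \<open>(1 + x q) (1 + y q\<^sup>3) G\<^bsub>8k+4\<^esub>(x q\<^sup>4, y q\<^sup>4)\<close>; iteration yields the product
  \<open>\<Prod>i. (1 + x q\<^bsup>4i+1\<^esup>) (1 + y q\<^bsup>4i+3\<^esup>)\<close>, which generates the numbers \<open>C4 u v n\<close>.\<close>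

section \<open>Weights and generating functions by largest part\<close>

definition a_weight :: "nat \<Rightarrow> nat" where
  "a_weight p = (if p mod 4 = 0 \<or> p mod 4 = 1 then 1 else if p mod 8 = 6 then 2 else 0)"

definition b_weight :: "nat \<Rightarrow> nat" where
  "b_weight p = (if p mod 4 = 0 \<or> p mod 4 = 3 then 1 else if p mod 8 = 2 then 2 else 0)"

text \<open>Over an arbitrary commutative ring, a substitution is just another choice of
  \<open>x\<close> and \<open>y\<close>. Replacing them by \<open>y * q ^ 2\<close> and
  \<open>x * q ^ 2\<close> turns the weight of \<open>p\<close> into that of \<open>p + 2\<close>
  for odd \<open>p\<close> and of \<open>p + 4\<close> for even \<open>p\<close>.\<close>

definition part_wt :: "'a::comm_ring_1 \<Rightarrow> 'a \<Rightarrow> 'a \<Rightarrow> nat \<Rightarrow> 'a" where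
  "part_wt x y q p = x ^ a_weight p * y ^ b_weight p * q ^ p"

definition list_wt :: "'a::comm_ring_1 \<Rightarrow> 'a \<Rightarrow> 'a \<Rightarrow> nat list \<Rightarrow> 'a" where
  "list_wt x y q xs = prod_list (map (part_wt x y q) xs)"

definition admissible :: "nat list \<Rightarrow> bool" where
  "admissible xs \<longleftrightarrow> successively D4_gap_ok xs \<and> 0 \<notin> set xs \<and> 2 \<notin> set xs"

definition admissible_hd :: "nat \<Rightarrow> nat list set" where
  "admissible_hd m = {xs. admissible xs \<and> xs \<noteq> [] \<and> hd xs = m}"

definition gf_hd :: "'a::comm_ring_1 \<Rightarrow> 'a \<Rightarrow> 'a \<Rightarrow> nat \<Rightarrow> 'a" where
  "gf_hd x y q m = (\<Sum>xs\<in>admissible_hd m. list_wt x y q xs)"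

definition gf_upto :: "'a::comm_ring_1 \<Rightarrow> 'a \<Rightarrow> 'a \<Rightarrow> nat \<Rightarrow> 'a" where
  "gf_upto x y q m = 1 + (\<Sum>j\<le>m. gf_hd x y q j)"

lemma gap_ok_less: "D4_gap_ok a b \<Longrightarrow> b < a"
  by (auto simp: D4_gap_ok_def)

lemma finite_gap_ok: "finite {j. D4_gap_ok m j}"
  by (rule finite_subset[of _ "{..<m}"]) (auto dest: gap_ok_less)

lemma admissible_hd_empty: "m = 0 \<or> m = 2 \<Longrightarrow> admissible_hd m = {}"
  by (auto simp: admissible_hd_def admissible_def dest: hd_in_set)

lemma admissible_hd_rec:
  assumes "m \<noteq> 0" "m \<noteq> 2"
  shows "admissible_hd m = Cons m ` insert [] (\<Union>j\<in>{j. D4_gap_ok m j}. admissible_hd j)"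
proof (intro set_eqI)
  fix xs
  show "xs \<in> admissible_hd m \<longleftrightarrow>
      xs \<in> Cons m ` insert [] (\<Union>j\<in>{j. D4_gap_ok m j}. admissible_hd j)"
  proof (cases xs)
    case (Cons a ys)
    then show ?thesis using assms
      by (cases ys) (auto simp: admissible_hd_def admissible_def image_iff)
  qed (auto simp: admissible_hd_def)
qed

lemma finite_admissible_hd: "finite (admissible_hd m)"
proof (induction m rule: less_induct)
  case (less m)
  show ?case
  proof (cases "m = 0 \<or> m = 2")
    case False
    then show ?thesis
      using less finite_gap_ok[of m] by (auto simp: admissible_hd_rec dest: gap_ok_less)
  qed (simp add: admissible_hd_empty)
qed

lemma sum_disjoint_admissible_hd:
  assumes "finite J"
  shows "(\<Sum>xs\<in>insert [] (\<Union>j\<in>J. admissible_hd j). f xs) =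
    f [] + (\<Sum>j\<in>J. \<Sum>xs\<in>admissible_hd j. f xs)"
proof -
  have "(\<Sum>xs\<in>(\<Union>j\<in>J. admissible_hd j). f xs) = (\<Sum>j\<in>J. \<Sum>xs\<in>admissible_hd j. f xs)"
    using assms finite_admissible_hd
    by (intro sum.UNION_disjoint) (auto simp: admissible_hd_def)
  moreover have "[] \<notin> (\<Union>j\<in>J. admissible_hd j)"
    by (auto simp: admissible_hd_def)
  ultimately show ?thesis
    using assms finite_admissible_hd by simp
qed

lemma gf_hd_0 [simp]: "gf_hd x y q 0 = 0" and gf_hd_2 [simp]: "gf_hd x y q 2 = 0"
  by (simp_all add: gf_hd_def admissible_hd_empty)

lemma gf_hd_rec:
  assumes "m \<noteq> 0" "m \<noteq> 2"
  shows "gf_hd x y q m = part_wt x y q m * (1 + (\<Sum>j | D4_gap_ok m j. gf_hd x y q j))"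
proof -
  let ?S = "insert [] (\<Union>j\<in>{j. D4_gap_ok m j}. admissible_hd j)"
  have "gf_hd x y q m = (\<Sum>xs\<in>?S. list_wt x y q (m # xs))"
    unfolding gf_hd_def admissible_hd_rec[OF assms] by (subst sum.reindex) auto
  also have "\<dots> = part_wt x y q m * (\<Sum>xs\<in>?S. list_wt x y q xs)"
    by (simp add: list_wt_def sum_distrib_left)
  also have "(\<Sum>xs\<in>?S. list_wt x y q xs) = 1 + (\<Sum>j | D4_gap_ok m j. gf_hd x y q j)"
    by (subst sum_disjoint_admissible_hd[OF finite_gap_ok]) (simp add: list_wt_def gf_hd_def)
  finally show ?thesis .
qed

lemma gf_upto_conv_sum:
  "gf_upto x y q m = (\<Sum>xs\<in>insert [] (\<Union>j\<in>{..m}. admissible_hd j). list_wt x y q xs)"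
  by (subst sum_disjoint_admissible_hd) (simp_all add: gf_upto_def gf_hd_def list_wt_def)

lemma gf_upto_0: "gf_upto x y q 0 = 1"
  by (simp add: gf_upto_def)

lemma gf_upto_step: "n = Suc m \<Longrightarrow> gf_upto x y q n = gf_upto x y q m + gf_hd x y q n"
  by (simp add: gf_upto_def add_ac)

lemma gf_hd_eq_gf_upto:
  assumes "{j. D4_gap_ok m j} = {..l}" "m \<noteq> 0" "m \<noteq> 2"
  shows "gf_hd x y q m = part_wt x y q m * gf_upto x y q l"
  using assms by (simp add: gf_hd_rec gf_upto_def)

text \<open>For parts congruent to 4, 5 or 6 modulo 8 the allowed next parts have a hole:
  \<open>l + 1\<close> is forbidden, \<open>l + 2\<close> is allowed. This is where
  \<open>gf_mid\<close> comes from.\<close>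

lemma gf_hd_eq_gf_upto_plus:
  assumes "{j. D4_gap_ok m j} = insert (l + 2) {..l}" "m \<noteq> 0" "m \<noteq> 2"
  shows "gf_hd x y q m = part_wt x y q m * (gf_upto x y q l + gf_hd x y q (l + 2))"
  using assms by (simp add: gf_hd_rec gf_upto_def add_ac)

lemma gf_hd_eq_part_wt:
  assumes "{j. D4_gap_ok m j} = {}" "m \<noteq> 0" "m \<noteq> 2"
  shows "gf_hd x y q m = part_wt x y q m"
  using assms by (simp add: gf_hd_rec)

text \<open>The value at \<open>k\<close> is the combination \<open>B\<^sub>k\<close> of the introduction, which reads \<open>1\<close> at \<open>k = 0\<close>.\<close>

fun gf_mid :: "'a::comm_ring_1 \<Rightarrow> 'a \<Rightarrow> 'a \<Rightarrow> nat \<Rightarrow> 'a" where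
  "gf_mid x y q 0 = 1"
| "gf_mid x y q (Suc k) = gf_upto x y q (8 * k + 5) + gf_hd x y q (8 * k + 7)"

section \<open>Recurrences along residues modulo 8 and the functional equations\<close>

lemma add_8_mult_mod:
  fixes k c :: nat
  shows "(8 * k + c) mod 8 = c mod 8" "(8 * k + c) mod 4 = c mod 4"
  using mod_mult_self4[of 4 "2 * k" c] by simp_all

lemma part_wt_shift:
  "part_wt x y q (8 * k + c) = q ^ (8 * k) * part_wt x y q c"
  unfolding part_wt_def a_weight_def b_weight_def add_8_mult_mod power_add by (simp only: mult_ac)

lemma gap_ok_iff:
  "D4_gap_ok a b \<longleftrightarrow> b + 5 \<le> a \<and> (a = b + 5 \<longrightarrow> a mod 8 \<in> {1,4}) \<and>
     (a = b + 6 \<longrightarrow> a mod 8 \<in> {1,3,5,7}) \<and> (a = b + 7 \<longrightarrow> a mod 8 \<in> {0,1,3,4,6,7}) \<and>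
     (a = b + 8 \<longrightarrow> a mod 8 \<in> {0,1,3,4,5,7})"
proof -
  have "int a - int b = 5 \<longleftrightarrow> a = b + 5" "int a - int b = 6 \<longleftrightarrow> a = b + 6"
    "int a - int b = 7 \<longleftrightarrow> a = b + 7" "int a - int b = 8 \<longleftrightarrow> a = b + 8"
    "int a - int b \<ge> 5 \<longleftrightarrow> b + 5 \<le> a"
    by linarith+
  then show ?thesis unfolding D4_gap_ok_def by (simp only:)
qed

text \<open>Offsets 7 to 14 cover every residue without a negative bound; the smaller parts have no
  successor. The values 0 and 2 in these sets do no harm, since \<open>gf_hd\<close> vanishes
  there.\<close>

lemma gap_ok_sets:
  fixes k :: nat
  shows "{j. D4_gap_ok (8 * k + 12) j} = insert (8 * k + 5 + 2) {..8 * k + 5}"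
    "{j. D4_gap_ok (8 * k + 13) j} = insert (8 * k + 5 + 2) {..8 * k + 5}"
    "{j. D4_gap_ok (8 * k + 14) j} = insert (8 * k + 5 + 2) {..8 * k + 5}"
    "{j. D4_gap_ok (8 * k + 7) j} = {..8 * k + 1}"
    "{j. D4_gap_ok (8 * k + 8) j} = {..8 * k + 1}"
    "{j. D4_gap_ok (8 * k + 9) j} = {..8 * k + 4}"
    "{j. D4_gap_ok (8 * k + 10) j} = {..8 * k + 1}"
    "{j. D4_gap_ok (8 * k + 11) j} = {..8 * k + 5}"
    "{j. D4_gap_ok 1 j} = {}" "{j. D4_gap_ok 3 j} = {}" "{j. D4_gap_ok 4 j} = {}"
    "{j. D4_gap_ok 5 j} = {}" "{j. D4_gap_ok 6 j} = {}"
  unfolding set_eq_iff mem_Collect_eq insert_iff atMost_iff gap_ok_iff add_8_mult_mod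
  by (intro allI; simp; linarith)+

lemma part_wt_small:
  "part_wt x y q 1 = x * q" "part_wt x y q 3 = y * q ^ 3" "part_wt x y q 4 = x * y * q ^ 4"
  "part_wt x y q 5 = x * q ^ 5" "part_wt x y q 6 = x ^ 2 * q ^ 6" "part_wt x y q 7 = y * q ^ 7"
  "part_wt x y q 8 = x * y * q ^ 8" "part_wt x y q 9 = x * q ^ 9"
  "part_wt x y q 10 = y ^ 2 * q ^ 10" "part_wt x y q 11 = y * q ^ 11"
  by (simp_all add: part_wt_def a_weight_def b_weight_def)

lemma gf_hd_small:
  "gf_hd x y q 1 = x * q" "gf_hd x y q 3 = y * q ^ 3" "gf_hd x y q 4 = x * y * q ^ 4"
  using gf_hd_eq_part_wt[OF gap_ok_sets(9), of x y q] gf_hd_eq_part_wt[OF gap_ok_sets(10), of x y q]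
    gf_hd_eq_part_wt[OF gap_ok_sets(11), of x y q] part_wt_small[of x y q] by simp_all

text \<open>The three residues share one set of next parts, with generating function
  \<open>gf_mid\<close>. The value 1 at \<open>k = 0\<close> accounts for 4, 5 and 6, which can only
  stand alone as largest parts.\<close>

lemma gf_hd_4_5_6:
  "gf_hd x y q (8 * k + 4) = q ^ (8 * k) * (x * y * q ^ 4) * gf_mid x y q k"
  "gf_hd x y q (8 * k + 5) = q ^ (8 * k) * (x * q ^ 5) * gf_mid x y q k"
  "gf_hd x y q (8 * k + 6) = q ^ (8 * k) * (x ^ 2 * q ^ 6) * gf_mid x y q k"
proof -
  have shift: "gf_hd x y q (8 * k + c) = q ^ (8 * k) * part_wt x y q c * gf_mid x y q k"
    if c: "c = 4 \<or> c = 5 \<or> c = 6" for c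
  proof (cases k)
    case 0
    have "{j. D4_gap_ok c j} = {}"
      using c gap_ok_sets(11-13) by blast
    then show ?thesis
      using gf_hd_eq_part_wt[of c x y q] c 0 by auto
  next
    case (Suc i)
    have "{j. D4_gap_ok (8 * i + (8 + c)) j} = insert (8 * i + 5 + 2) {..8 * i + 5}"
      using c by (elim disjE) (simp_all add: gap_ok_sets)
    then have "gf_hd x y q (8 * i + (8 + c)) =
        part_wt x y q (8 * i + (8 + c)) * (gf_upto x y q (8 * i + 5) + gf_hd x y q (8 * i + 5 + 2))"
      by (rule gf_hd_eq_gf_upto_plus) (use c in auto)
    moreover have "8 * k + c = 8 * i + (8 + c)"
      using Suc by simp
    ultimately show ?thesis
      using part_wt_shift[of x y q k c] Suc by (simp add: add_ac)
  qed
  show "gf_hd x y q (8 * k + 4) = q ^ (8 * k) * (x * y * q ^ 4) * gf_mid x y q k"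
    "gf_hd x y q (8 * k + 5) = q ^ (8 * k) * (x * q ^ 5) * gf_mid x y q k"
    "gf_hd x y q (8 * k + 6) = q ^ (8 * k) * (x ^ 2 * q ^ 6) * gf_mid x y q k"
    using shift[of 4] shift[of 5] shift[of 6] by (simp_all add: part_wt_small)
qed

lemma gf_hd_others:
  "gf_hd x y q (8 * k + 7) = q ^ (8 * k) * (y * q ^ 7) * gf_upto x y q (8 * k + 1)"
  "gf_hd x y q (8 * k + 8) = q ^ (8 * k) * (x * y * q ^ 8) * gf_upto x y q (8 * k + 1)"
  "gf_hd x y q (8 * k + 9) = q ^ (8 * k) * (x * q ^ 9) * gf_upto x y q (8 * k + 4)"
  "gf_hd x y q (8 * k + 10) = q ^ (8 * k) * (y ^ 2 * q ^ 10) * gf_upto x y q (8 * k + 1)"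
  "gf_hd x y q (8 * k + 11) = q ^ (8 * k) * (y * q ^ 11) * gf_upto x y q (8 * k + 5)"
  by (simp_all add: gf_hd_eq_gf_upto[OF gap_ok_sets(4)] gf_hd_eq_gf_upto[OF gap_ok_sets(5)]
      gf_hd_eq_gf_upto[OF gap_ok_sets(6)] gf_hd_eq_gf_upto[OF gap_ok_sets(7)]
      gf_hd_eq_gf_upto[OF gap_ok_sets(8)] part_wt_shift part_wt_small)

lemma gf_upto_steps:
  fixes k :: nat
  shows
  "gf_upto x y q (8 * k + 5) = gf_upto x y q (8 * k + 4) + gf_hd x y q (8 * k + 5)"
  "gf_upto x y q (8 * k + 6) = gf_upto x y q (8 * k + 5) + gf_hd x y q (8 * k + 6)"
  "gf_upto x y q (8 * k + 7) = gf_upto x y q (8 * k + 6) + gf_hd x y q (8 * k + 7)"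
  "gf_upto x y q (8 * k + 8) = gf_upto x y q (8 * k + 7) + gf_hd x y q (8 * k + 8)"
  "gf_upto x y q (8 * k + 9) = gf_upto x y q (8 * k + 8) + gf_hd x y q (8 * k + 9)"
  "gf_upto x y q (8 * k + 10) = gf_upto x y q (8 * k + 9) + gf_hd x y q (8 * k + 10)"
  "gf_upto x y q (8 * k + 11) = gf_upto x y q (8 * k + 10) + gf_hd x y q (8 * k + 11)"
  "gf_upto x y q (8 * k + 12) = gf_upto x y q (8 * k + 11) + gf_hd x y q (8 * k + 12)"
  by (rule gf_upto_step, simp)+

lemma gf_upto_1: "gf_upto x y q 1 = 1 + x * q"
  using gf_upto_step[of 1 0 x y q] by (simp add: gf_upto_0 gf_hd_small[simplified])

lemma gf_upto_4: "gf_upto x y q 4 = (1 + x * q) * (1 + y * q ^ 3)"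
proof -
  have "gf_upto x y q 4 = gf_upto x y q 1 + gf_hd x y q 3 + gf_hd x y q 4"
    using gf_upto_step[of 2 1 x y q] gf_upto_step[of 3 2 x y q] gf_upto_step[of 4 3 x y q] by simp
  then show ?thesis
    unfolding gf_upto_1 gf_hd_small by (simp add: algebra_simps power_numeral_reduce del: gf_mid.simps)
qed

text \<open>With the two recurrences that follow, this gives a closed system for
  \<open>gf_mid\<close> at \<open>k\<close> and \<open>gf_upto\<close> at \<open>8k+1\<close> and
  \<open>8k+4\<close>.\<close>

lemma gf_mid_rec:
  "gf_mid x y q (Suc k) = gf_upto x y q (8 * k + 4) + q ^ (8 * k) * (x * q ^ 5) * gf_mid x y q k
     + q ^ (8 * k) * (y * q ^ 7) * gf_upto x y q (8 * k + 1)"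
  by (simp add: gf_upto_steps gf_hd_4_5_6 gf_hd_others)

text \<open>The largest parts \<open>8k+6\<close> and \<open>8k+8\<close> contribute
  \<open>x * q\<close> times what \<open>8k+5\<close> and \<open>8k+7\<close> contribute, and the
  latter two add up to \<open>gf_mid\<close> at \<open>k+1\<close> minus \<open>gf_upto\<close> at
  \<open>8k+4\<close>.\<close>

lemma gf_upto_9_rec:
  "gf_upto x y q (8 * k + 9) = (1 + x * q) * gf_mid x y q (Suc k)
     - x * q * (1 - q ^ (8 * k) * q ^ 8) * gf_upto x y q (8 * k + 4)"
proof -
  have "gf_upto x y q (8 * k + 9) = gf_mid x y q (Suc k) + gf_hd x y q (8 * k + 6)
      + gf_hd x y q (8 * k + 8) + gf_hd x y q (8 * k + 9)"
    by (simp add: gf_upto_steps)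
  then show ?thesis
    unfolding gf_hd_4_5_6 gf_hd_others gf_mid_rec by (simp add: algebra_simps power_numeral_reduce del: gf_mid.simps)
qed

text \<open>Writing \<open>gf_upto\<close> at \<open>8k+5\<close> as \<open>gf_mid\<close> at
  \<open>k+1\<close> minus \<open>gf_hd\<close> at \<open>8k+7\<close> splits the term of
  \<open>8k+11\<close>: one piece joins the term of \<open>8k+12\<close>, the other that of
  \<open>8k+10\<close>.\<close>

lemma gf_upto_12_rec:
  "gf_upto x y q (8 * k + 12) = gf_upto x y q (8 * k + 9)
     + q ^ (8 * k) * (y ^ 2 * q ^ 10) * (1 - q ^ (8 * k) * q ^ 8) * gf_upto x y q (8 * k + 1)
     + q ^ (8 * k) * (y * q ^ 11) * (1 + x * q) * gf_mid x y q (Suc k)"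
proof -
  have split: "gf_upto x y q (8 * k + 12) = gf_upto x y q (8 * k + 9) + gf_hd x y q (8 * k + 10)
      + gf_hd x y q (8 * k + 11) + gf_hd x y q (8 * k + 12)"
    by (simp add: gf_upto_steps)
  have hd_12: "gf_hd x y q (8 * k + 12) =
      q ^ (8 * k) * (x * y * q ^ 12) * gf_mid x y q (Suc k)"
    using gf_hd_4_5_6(1)[of x y q "Suc k"] by (simp add: power_add add_ac mult_ac del: gf_mid.simps)
  have upto_5: "gf_upto x y q (8 * k + 5) =
      gf_mid x y q (Suc k) - q ^ (8 * k) * (y * q ^ 7) * gf_upto x y q (8 * k + 1)"
    by (simp add: gf_hd_others)
  show ?thesis
    unfolding split hd_12 gf_hd_others upto_5
    by (simp add: algebra_simps power_numeral_reduce del: gf_mid.simps)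
qed

text \<open>\<open>A\<close>, \<open>B\<close>, \<open>D\<close> stand for \<open>G\<^bsub>8k+1\<^esub>\<close>, \<open>B\<^sub>k\<close>, \<open>G\<^bsub>8k+4\<^esub>\<close>, the suffix \<open>1\<close> for the index \<open>k + 1\<close>,
  and a prime for the substitution of \<open>y q\<^sup>2\<close>, \<open>x q\<^sup>2\<close> for \<open>x\<close>, \<open>y\<close>. The third equation is carried along
  because the recurrence for \<open>B1'\<close> involves \<open>D'\<close>.\<close>

lemma functional_equation_step:
  fixes x y q Q A B D A1 B1 D1 A' B' D' A1' B1' D1' :: "'a::comm_ring_1"
  assumes B1: "B1 = D + Q * (x * q ^ 5) * B + Q * (y * q ^ 7) * A"
    and A1: "A1 = (1 + x * q) * B1 - x * q * (1 - Q * q ^ 8) * D"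
    and D1: "D1 = A1 + Q * (y ^ 2 * q ^ 10) * (1 - Q * q ^ 8) * A
      + Q * (y * q ^ 11) * (1 + x * q) * B1"
    and B1': "B1' = D' + Q * (y * q ^ 7) * B' + Q * (x * q ^ 9) * A'"
    and A1': "A1' = (1 + y * q ^ 3) * B1' - y * q ^ 3 * (1 - Q * q ^ 8) * D'"
    and D1': "D1' = A1' + Q * (x ^ 2 * q ^ 14) * (1 - Q * q ^ 8) * A'
      + Q * (x * q ^ 13) * (1 + y * q ^ 3) * B1'"
    and A: "A = (1 + x * q) * B'"
    and D: "D = (1 + x * q) * A'"
    and D': "D + Q * (x * q ^ 5) * (1 + x * q) * B + Q * (x * y * q ^ 8) * A = (1 + x * q) * D'"
  shows "A1 = (1 + x * q) * B1'"
    and "D1 = (1 + x * q) * A1'"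
    and "D1 + Q * (x * q ^ 13) * (1 + x * q) * B1 + Q * (x * y * q ^ 16) * A1 = (1 + x * q) * D1'"
proof -
  define c where "c = 1 + x * q"
  \<comment> \<open>Nothing is divided by \<open>c\<close>: each primed recurrence is multiplied by
    \<open>c\<close>, and \<open>A\<close>, \<open>D\<close>, \<open>D'\<close> turn the products
    into unprimed quantities.\<close>
  have "c * B1' = c * D' + Q * (y * q ^ 7) * (c * B') + Q * (x * q ^ 9) * (c * A')"
    unfolding B1' by (simp add: algebra_simps)
  also have "\<dots> = A1"
    unfolding c_def A[symmetric] D[symmetric] D'[symmetric] A1 B1
    by (simp add: algebra_simps power_numeral_reduce)
  finally have I: "c * B1' = A1" .
  have "c * A1' = (1 + y * q ^ 3) * (c * B1') - y * q ^ 3 * (1 - Q * q ^ 8) * (c * D')"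
    unfolding A1' by (simp add: algebra_simps)
  also have "\<dots> = D1"
    unfolding I unfolding c_def D'[symmetric] D1 A1 B1
    by (simp add: algebra_simps power_numeral_reduce)
  finally have II: "c * A1' = D1" .
  have "c * D1' = c * A1' + Q * (x ^ 2 * q ^ 14) * (1 - Q * q ^ 8) * (c * A')
      + Q * (x * q ^ 13) * (1 + y * q ^ 3) * (c * B1')"
    unfolding D1' by (simp add: algebra_simps)
  also have "\<dots> = D1 + Q * (x * q ^ 13) * c * B1 + Q * (x * y * q ^ 16) * A1"
    unfolding I II unfolding c_def D[symmetric] A1
    by (simp add: algebra_simps power_numeral_reduce)
  finally have III: "c * D1' = D1 + Q * (x * q ^ 13) * c * B1 + Q * (x * y * q ^ 16) * A1" .
  show "A1 = (1 + x * q) * B1'" "D1 = (1 + x * q) * A1'"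
    "D1 + Q * (x * q ^ 13) * (1 + x * q) * B1 + Q * (x * y * q ^ 16) * A1 = (1 + x * q) * D1'"
    using I II III by (simp_all add: c_def)
qed

theorem gf_functional_equations:
  "gf_upto x y q (8 * k + 1) = (1 + x * q) * gf_mid (y * q ^ 2) (x * q ^ 2) q k"
  "gf_upto x y q (8 * k + 4) = (1 + x * q) * gf_upto (y * q ^ 2) (x * q ^ 2) q (8 * k + 1)"
proof -
  let ?x = "y * q ^ 2" and ?y = "x * q ^ 2"
  have "gf_upto x y q (8 * k + 1) = (1 + x * q) * gf_mid ?x ?y q k \<and>
    gf_upto x y q (8 * k + 4) = (1 + x * q) * gf_upto ?x ?y q (8 * k + 1) \<and>
    gf_upto x y q (8 * k + 4) + q ^ (8 * k) * (x * q ^ 5) * (1 + x * q) * gf_mid x y q k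
      + q ^ (8 * k) * (x * y * q ^ 8) * gf_upto x y q (8 * k + 1)
      = (1 + x * q) * gf_upto ?x ?y q (8 * k + 4)"
  proof (induction k)
    case 0
    show ?case
      by (simp add: gf_upto_4 gf_upto_1[simplified] algebra_simps power_numeral_reduce)
  next
    case (Suc k)
    \<comment> \<open>The recurrences at the substituted arguments: \<open>x * q ^ 5\<close> becomes
      \<open>y * q ^ 7\<close>, \<open>y * q ^ 7\<close> becomes \<open>x * q ^ 9\<close>, and
      powers of \<open>q\<close> alone stay fixed.\<close>
    have B1': "gf_mid ?x ?y q (Suc k) = gf_upto ?x ?y q (8 * k + 4)
        + q ^ (8 * k) * (y * q ^ 7) * gf_mid ?x ?y q k
        + q ^ (8 * k) * (x * q ^ 9) * gf_upto ?x ?y q (8 * k + 1)"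
      unfolding gf_mid_rec by (simp add: mult.assoc flip: power_add)
    have A1': "gf_upto ?x ?y q (8 * k + 9) = (1 + y * q ^ 3) * gf_mid ?x ?y q (Suc k)
        - y * q ^ 3 * (1 - q ^ (8 * k) * q ^ 8) * gf_upto ?x ?y q (8 * k + 4)"
      unfolding gf_upto_9_rec by (simp add: power_numeral_reduce mult.assoc)
    have D1': "gf_upto ?x ?y q (8 * k + 12) = gf_upto ?x ?y q (8 * k + 9)
        + q ^ (8 * k) * (x ^ 2 * q ^ 14) * (1 - q ^ (8 * k) * q ^ 8) * gf_upto ?x ?y q (8 * k + 1)
        + q ^ (8 * k) * (x * q ^ 13) * (1 + y * q ^ 3) * gf_mid ?x ?y q (Suc k)"
      unfolding gf_upto_12_rec by (simp add: power_numeral_reduce mult_ac)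
    note step = functional_equation_step[OF gf_mid_rec gf_upto_9_rec gf_upto_12_rec B1' A1' D1'
        conjunct1[OF Suc.IH] conjunct1[OF conjunct2[OF Suc.IH]] conjunct2[OF conjunct2[OF Suc.IH]]]
    have "8 * Suc k + 1 = 8 * k + 9" "8 * Suc k + 4 = 8 * k + 12"
      "q ^ (8 * Suc k) = q ^ (8 * k) * q ^ 8"
      by (simp_all add: power_add mult_ac)
    then show ?case
      using step by (simp only:) (simp add: mult_ac power_numeral_reduce)
  qed
  then show "gf_upto x y q (8 * k + 1) = (1 + x * q) * gf_mid ?x ?y q k"
    "gf_upto x y q (8 * k + 4) = (1 + x * q) * gf_upto ?x ?y q (8 * k + 1)"
    by blast+
qed

section \<open>Congruences modulo powers of \<open>q\<close> and the product\<close>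

lemma power_dvd_gf_hd: "q ^ m dvd gf_hd x y q m"
proof (cases "m = 0 \<or> m = 2")
  case False
  then show ?thesis by (simp add: gf_hd_rec part_wt_def)
qed auto

text \<open>Every part has a positive exponent in \<open>x\<close> or in \<open>y\<close>. Hence
  only the empty partition survives modulo a common divisor of \<open>x\<close> and
  \<open>y\<close>.\<close>

lemma dvd_gf_hd:
  assumes "r dvd x" "r dvd y"
  shows "r dvd gf_hd x y q m"
proof (cases "m = 0 \<or> m = 2")
  case False
  have "m mod 4 = 0 \<or> m mod 4 = 1 \<or> m mod 4 = 3 \<or> m mod 8 = 2 \<or> m mod 8 = 6"
    by presburger
  then have "a_weight m \<noteq> 0 \<or> b_weight m \<noteq> 0"
    by (auto simp: a_weight_def b_weight_def)
  then have "x dvd x ^ a_weight m \<or> y dvd y ^ b_weight m"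
    by (auto intro: dvd_power)
  then have "r dvd part_wt x y q m"
    unfolding part_wt_def using assms by (meson dvd_mult dvd_mult2 dvd_trans)
  with False show ?thesis by (simp add: gf_hd_rec)
qed auto

lemma dvd_gf_upto_minus_1:
  assumes "r dvd x" "r dvd y"
  shows "r dvd gf_upto x y q m - 1"
  using assms by (simp add: gf_upto_def dvd_sum dvd_gf_hd)

text \<open>The two sides differ only by partitions with largest part at least \<open>8k+6\<close>.
  The index is \<open>k+1\<close>, so the exponent is \<open>8(k+1) - 2\<close>.\<close>

lemma gf_upto_cong_gf_mid:
  "q ^ (8 * k + 6) dvd gf_upto x y q (8 * k + 12) - gf_mid x y q (Suc k)"
proof -
  have "q ^ (8 * k + 6) dvd gf_hd x y q (8 * k + c)" if "c \<ge> 6" for c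
    using power_dvd_gf_hd[of q "8 * k + c" x y] that
    by (meson add_le_cancel_left dvd_trans le_imp_power_dvd)
  then have "q ^ (8 * k + 6) dvd gf_hd x y q (8 * k + 6) + gf_hd x y q (8 * k + 8)
     + gf_hd x y q (8 * k + 9) + gf_hd x y q (8 * k + 10) + gf_hd x y q (8 * k + 11)
     + gf_hd x y q (8 * k + 12)"
    by (intro dvd_add) auto
  moreover have "gf_upto x y q (8 * k + 12) - gf_mid x y q (Suc k) =
     gf_hd x y q (8 * k + 6) + gf_hd x y q (8 * k + 8)
     + gf_hd x y q (8 * k + 9) + gf_hd x y q (8 * k + 10) + gf_hd x y q (8 * k + 11)
     + gf_hd x y q (8 * k + 12)"
    by (simp add: gf_upto_steps)
  ultimately show ?thesis by simp
qed

text \<open>Composing the two functional equations swaps the variables twice, which restores their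
  order and leaves a factor \<open>q ^ 4\<close> on each. Up to here the identity is exact; only
  replacing \<open>gf_mid\<close> by \<open>gf_upto\<close> costs precision.\<close>

lemma gf_upto_cong_shift:
  "q ^ (8 * k + 6) dvd gf_upto x y q (8 * k + 12)
     - (1 + x * q) * (1 + y * q ^ 3) * gf_upto (x * q ^ 4) (y * q ^ 4) q (8 * k + 12)"
proof -
  have "gf_upto x y q (8 * k + 12) =
      (1 + x * q) * (1 + y * q ^ 3) * gf_mid (x * q ^ 4) (y * q ^ 4) q (Suc k)"
    using gf_functional_equations(2)[of x y q "Suc k"]
      gf_functional_equations(1)[of "y * q ^ 2" "x * q ^ 2" q "Suc k"]
    by (simp add: mult.assoc add_ac del: gf_mid.simps flip: power_add power_Suc2)
  then have "gf_upto x y q (8 * k + 12)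
      - (1 + x * q) * (1 + y * q ^ 3) * gf_upto (x * q ^ 4) (y * q ^ 4) q (8 * k + 12) =
      - ((1 + x * q) * (1 + y * q ^ 3)) * (gf_upto (x * q ^ 4) (y * q ^ 4) q (8 * k + 12)
        - gf_mid (x * q ^ 4) (y * q ^ 4) q (Suc k))"
    by (simp add: right_diff_distrib del: gf_mid.simps)
  then show ?thesis
    using gf_upto_cong_gf_mid[of q k "x * q ^ 4" "y * q ^ 4"] by (simp only: dvd_mult)
qed

lemma gf_upto_cong_iterate:
  "q ^ (8 * k + 6) dvd gf_upto x y q (8 * k + 12)
     - (\<Prod>i<j. (1 + x * q ^ (4 * i + 1)) * (1 + y * q ^ (4 * i + 3)))
       * gf_upto (x * q ^ (4 * j)) (y * q ^ (4 * j)) q (8 * k + 12)"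
proof (induction j)
  case (Suc j)
  let ?P = "\<Prod>i<j. (1 + x * q ^ (4 * i + 1)) * (1 + y * q ^ (4 * i + 3))"
  let ?F = "\<lambda>j. gf_upto (x * q ^ (4 * j)) (y * q ^ (4 * j)) q (8 * k + 12)"
  have "q ^ (8 * k + 6) dvd
      ?F j - (1 + x * q ^ (4 * j + 1)) * (1 + y * q ^ (4 * j + 3)) * ?F (Suc j)"
    using gf_upto_cong_shift[of q k "x * q ^ (4 * j)" "y * q ^ (4 * j)"]
    by (simp add: power_add mult_ac)
  then have "q ^ (8 * k + 6) dvd (gf_upto x y q (8 * k + 12) - ?P * ?F j)
      + ?P * (?F j - (1 + x * q ^ (4 * j + 1)) * (1 + y * q ^ (4 * j + 3)) * ?F (Suc j))"
    using Suc.IH by (intro dvd_add dvd_mult)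
  then show ?case
    by (simp add: right_diff_distrib mult.assoc)
qed simp

text \<open>After \<open>2k+2\<close> iterations both arguments are multiples of
  \<open>q ^ (8k+8)\<close>, so the remaining \<open>gf_upto\<close> is 1 to the required
  precision.\<close>

theorem gf_upto_cong_prod:
  "q ^ (8 * k + 6) dvd gf_upto x y q (8 * k + 12)
     - (\<Prod>i<2 * k + 2. (1 + x * q ^ (4 * i + 1)) * (1 + y * q ^ (4 * i + 3)))"
proof -
  let ?P = "\<Prod>i<2 * k + 2. (1 + x * q ^ (4 * i + 1)) * (1 + y * q ^ (4 * i + 3))"
  let ?F = "gf_upto (x * q ^ (4 * (2 * k + 2))) (y * q ^ (4 * (2 * k + 2))) q (8 * k + 12)"
  have "q ^ (4 * (2 * k + 2)) dvd ?F - 1"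
    by (rule dvd_gf_upto_minus_1) simp_all
  moreover have "q ^ (8 * k + 6) dvd q ^ (4 * (2 * k + 2))"
    by (rule le_imp_power_dvd) simp
  ultimately have "q ^ (8 * k + 6) dvd (gf_upto x y q (8 * k + 12) - ?P * ?F) + ?P * (?F - 1)"
    using gf_upto_cong_iterate[of q k x y "2 * k + 2"]
    by (intro dvd_add dvd_mult) (auto intro: dvd_trans)
  then show ?thesis
    by (simp add: right_diff_distrib)
qed

section \<open>Expansion of the product and exponents of list weights\<close>

definition odd_wt :: "'a::comm_ring_1 \<Rightarrow> 'a \<Rightarrow> 'a \<Rightarrow> nat \<Rightarrow> 'a" where
  "odd_wt x y q p = (if p mod 4 = 1 then x else y) * q ^ p"

text \<open>The odd numbers below \<open>4 * j\<close> are the \<open>4 * i + 1\<close> and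
  \<open>4 * i + 3\<close> with \<open>i < j\<close>; expanding selects a set of them as
  parts.\<close>

lemma prod_odd_conv_sum:
  "(\<Prod>i<j. (1 + x * q ^ (4 * i + 1)) * (1 + y * q ^ (4 * i + 3))) =
     (\<Sum>S | S \<subseteq> {p. p < 4 * j \<and> odd p}. \<Prod>p\<in>S. odd_wt x y q p)"
proof -
  have "(\<Prod>p | p < 4 * j \<and> odd p. odd_wt x y q p + 1) =
      (\<Prod>i<j. (1 + x * q ^ (4 * i + 1)) * (1 + y * q ^ (4 * i + 3)))"
  proof (induction j)
    case (Suc j)
    have "{p. p < 4 * Suc j \<and> odd p} =
        insert (4 * j + 1) (insert (4 * j + 3) {p. p < 4 * j \<and> odd p})"
      by (auto; presburger)
    moreover have "(4 * j + 1) mod 4 = 1" "(4 * j + 3) mod 4 = 3"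
      by presburger+
    ultimately show ?case
      using Suc.IH by (simp add: odd_wt_def add_ac mult_ac)
  qed simp
  then show ?thesis
    by (simp add: prod_add Pow_def)
qed

lemma prod_odd_wt:
  assumes "finite S" "\<forall>p\<in>S. p mod 4 = 1 \<or> p mod 4 = 3"
  shows "(\<Prod>p\<in>S. odd_wt x y q p) =
    x ^ card {p\<in>S. p mod 4 = 1} * y ^ card {p\<in>S. p mod 4 = 3} * q ^ \<Sum>S"
  using assms
proof (induction S)
  case (insert p S)
  have "{r \<in> insert p S. r mod 4 = c} =
      (if p mod 4 = c then insert p {r\<in>S. r mod 4 = c} else {r\<in>S. r mod 4 = c})" for c :: nat
    by auto
  with insert show ?case
    by (auto simp: odd_wt_def power_add mult_ac)
qed simp

lemma list_wt_eq:
  "list_wt x y q xs =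
     x ^ sum_list (map a_weight xs) * y ^ sum_list (map b_weight xs) * q ^ sum_list xs"
  by (induction xs) (simp_all add: list_wt_def part_wt_def power_add mult_ac)

lemma sum_list_a_weight:
  "sum_list (map a_weight xs) = length (filter (\<lambda>x. x mod 4 = 0 \<or> x mod 4 = 1) xs)
           + 2 * length (filter (\<lambda>x. x mod 8 = 6) xs)"
proof (induction xs)
  case (Cons p xs)
  have "p mod 8 = 6 \<Longrightarrow> p mod 4 = 2" by presburger
  with Cons show ?case by (auto simp: a_weight_def)
qed simp

lemma sum_list_b_weight:
  "sum_list (map b_weight xs) = length (filter (\<lambda>x. x mod 4 = 0 \<or> x mod 4 = 3) xs)
           + 2 * length (filter (\<lambda>x. x mod 8 = 2) xs)"
proof (induction xs)
  case (Cons p xs)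
  have "p mod 8 = 2 \<Longrightarrow> p mod 4 = 2" by presburger
  with Cons show ?case by (auto simp: b_weight_def)
qed simp

section \<open>Coefficient extraction and the two counts\<close>

text \<open>The innermost indeterminate is \<open>x\<close>, the middle one \<open>y\<close>, the
  outermost \<open>q\<close>. With \<open>q\<close> outermost, divisibility by a power of
  \<open>q\<close> kills low coefficients of the outer polynomial.\<close>

definition monom3 :: "nat \<Rightarrow> nat \<Rightarrow> nat \<Rightarrow> int poly poly poly" where
  "monom3 u v n = monom (monom (monom 1 u) v) n"

lemma monom3_eq: "monom3 1 0 0 ^ u * monom3 0 1 0 ^ v * monom3 0 0 1 ^ n = monom3 u v n"
  by (simp add: monom3_def monom_power mult_monom)

lemma coeff_sum_monom3:
  assumes "finite A"
  shows "coeff (coeff (coeff (\<Sum>a\<in>A. monom3 (f a) (g a) (h a)) n) v) u =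
    int (card {a\<in>A. f a = u \<and> g a = v \<and> h a = n})"
proof -
  have "coeff (coeff (coeff (\<Sum>a\<in>A. monom3 (f a) (g a) (h a)) n) v) u =
      (\<Sum>a\<in>A. if f a = u \<and> g a = v \<and> h a = n then 1 else 0)"
    unfolding coeff_sum by (rule sum.cong) (auto simp: monom3_def)
  also have "\<dots> = int (card {a\<in>A. f a = u \<and> g a = v \<and> h a = n})"
    using assms by (simp add: sum.If_cases Int_def)
  finally show ?thesis .
qed

lemma coeff_eq_0_of_monom3_dvd:
  assumes "monom3 0 0 1 ^ m dvd P" "n < m"
  shows "coeff P n = 0"
proof -
  have "monom3 0 0 1 ^ m = monom 1 m"
    by (simp add: monom3_def monom_power flip: one_pCons monom_0)
  with assms show ?thesis
    by (auto simp: dvd_def coeff_monom_mult)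
qed

text \<open>The largest part is at most the sum \<open>n\<close>, and the gap condition already
  forces the parts to decrease.\<close>

lemma D4_conv_card:
  assumes "n \<le> N"
  shows "D4 u v n = card {xs \<in> insert [] (\<Union>j\<in>{..N}. admissible_hd j).
    sum_list (map a_weight xs) = u \<and> sum_list (map b_weight xs) = v \<and> sum_list xs = n}"
proof -
  have "((\<forall>i<length xs - 1. xs ! i \<ge> xs ! (i+1)) \<and> (\<forall>x\<in>set xs. x > 0) \<and> sum_list xs = n \<and>
       (\<forall>x\<in>set xs. x \<noteq> 2) \<and>
       (\<forall>i. i + 1 < length xs \<longrightarrow> D4_gap_ok (xs ! i) (xs ! (i+1)))) \<longleftrightarrow>
     xs \<in> insert [] (\<Union>j\<in>{..N}. admissible_hd j) \<and> sum_list xs = n" for xs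
  proof -
    have "xs ! i \<ge> xs ! (i+1)"
      if "\<forall>i. i + 1 < length xs \<longrightarrow> D4_gap_ok (xs ! i) (xs ! (i+1))" "i < length xs - 1" for i
      using that gap_ok_less[of "xs ! i" "xs ! (i+1)"] by auto
    moreover have "hd xs \<le> N" if "xs \<noteq> []" "sum_list xs = n"
      using that assms member_le_sum_list[of "hd xs" xs] by simp
    moreover have "successively D4_gap_ok xs \<longleftrightarrow>
        (\<forall>i. i + 1 < length xs \<longrightarrow> D4_gap_ok (xs ! i) (xs ! (i+1)))"
      by (simp add: successively_conv_nth)
    moreover have "(\<forall>x\<in>set xs. x > 0) \<longleftrightarrow> 0 \<notin> set xs" "(\<forall>x\<in>set xs. x \<noteq> 2) \<longleftrightarrow> 2 \<notin> set xs"
      by (metis gr0I less_irrefl) metis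
    ultimately show ?thesis
      by (cases "xs = []") (auto simp: admissible_hd_def admissible_def)
  qed
  then show ?thesis
    unfolding D4_def sum_list_a_weight sum_list_b_weight
    by (intro arg_cong[where f = card]) blast
qed

lemma C4_conv_card:
  assumes "n < 4 * j"
  shows "C4 u v n = card {S \<in> {S. S \<subseteq> {p. p < 4 * j \<and> odd p}}.
    card {p\<in>S. p mod 4 = 1} = u \<and> card {p\<in>S. p mod 4 = 3} = v \<and> \<Sum>S = n}"
proof -
  have "finite S \<and> (\<forall>x\<in>S. x mod 4 = 1 \<or> x mod 4 = 3) \<longleftrightarrow> S \<subseteq> {p. p < 4 * j \<and> odd p}"
    if "\<Sum>S = n" for S
  proof -
    have "x < 4 * j" if "finite S" "x \<in> S" for x
      using member_le_sum[of x S "\<lambda>x. x"] that \<open>\<Sum>S = n\<close> assms by simp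
    moreover have "odd x \<longleftrightarrow> x mod 4 = 1 \<or> x mod 4 = 3" for x :: nat
      by presburger
    moreover have "finite S" if "S \<subseteq> {p. p < 4 * j \<and> odd p}"
      by (rule finite_subset[OF that]) simp
    ultimately show ?thesis by blast
  qed
  then show ?thesis
    unfolding C4_def by (intro arg_cong[where f = card]) blast
qed

theorem theorem2p3:
  fixes u v n :: nat
  shows "C4 u v n = D4 u v n"
proof -
  let ?x = "monom3 1 0 0" and ?y = "monom3 0 1 0" and ?q = "monom3 0 0 1"
  \<comment> \<open>The congruence is applied with \<open>k = n\<close>: the bound
    \<open>8 * n + 12\<close> admits every partition of \<open>n\<close>, the
    \<open>2 * n + 2\<close> factors reach every odd part up to \<open>n\<close>, and the modulus
    \<open>q ^ (8 * n + 6)\<close> lies beyond degree \<open>n\<close>.\<close>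
  let ?L = "insert [] (\<Union>j\<in>{..8 * n + 12}. admissible_hd j)"
  let ?O = "{S. S \<subseteq> {p. p < 4 * (2 * n + 2) \<and> odd p}}"
  let ?P = "\<Prod>i<2 * n + 2. (1 + ?x * ?q ^ (4 * i + 1)) * (1 + ?y * ?q ^ (4 * i + 3))"
  have "gf_upto ?x ?y ?q (8 * n + 12) = (\<Sum>xs\<in>?L.
      monom3 (sum_list (map a_weight xs)) (sum_list (map b_weight xs)) (sum_list xs))"
    by (simp only: gf_upto_conv_sum list_wt_eq monom3_eq)
  moreover have "finite ?L"
    using finite_admissible_hd by simp
  ultimately have D: "int (D4 u v n) =
      coeff (coeff (coeff (gf_upto ?x ?y ?q (8 * n + 12)) n) v) u"
    by (simp only: coeff_sum_monom3 D4_conv_card[of n "8 * n + 12" u v])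
  have "?P = (\<Sum>S\<in>?O. \<Prod>p\<in>S. odd_wt ?x ?y ?q p)"
    by (rule prod_odd_conv_sum)
  also have "\<dots> = (\<Sum>S\<in>?O.
      monom3 (card {p\<in>S. p mod 4 = 1}) (card {p\<in>S. p mod 4 = 3}) (\<Sum>S))"
  proof (rule sum.cong)
    fix S assume S: "S \<in> ?O"
    then have "finite S"
      by (auto intro: finite_subset)
    moreover have "\<forall>p\<in>S. p mod 4 = 1 \<or> p mod 4 = 3"
    proof
      fix p assume "p \<in> S"
      with S have "odd p" by blast
      then show "p mod 4 = 1 \<or> p mod 4 = 3" by presburger
    qed
    ultimately show "(\<Prod>p\<in>S. odd_wt ?x ?y ?q p) =
        monom3 (card {p\<in>S. p mod 4 = 1}) (card {p\<in>S. p mod 4 = 3}) (\<Sum>S)"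
      by (simp only: prod_odd_wt monom3_eq)
  qed simp
  finally have "?P = (\<Sum>S\<in>?O.
      monom3 (card {p\<in>S. p mod 4 = 1}) (card {p\<in>S. p mod 4 = 3}) (\<Sum>S))" .
  moreover have "finite ?O" by simp
  moreover have "n < 4 * (2 * n + 2)" by simp
  ultimately have C: "int (C4 u v n) = coeff (coeff (coeff ?P n) v) u"
    by (simp only: coeff_sum_monom3 C4_conv_card)
  have "coeff (gf_upto ?x ?y ?q (8 * n + 12) - ?P) n = 0"
    by (rule coeff_eq_0_of_monom3_dvd[OF gf_upto_cong_prod]) simp
  then have "int (C4 u v n) = int (D4 u v n)"
    unfolding C D by simp
  then show ?thesis by simp
qed

end
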